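(* If there exists a pair of orthogonal quantum Latin squares of order $6$, then there exists a pair $\Psi,\Phi$ of orthogonal quantum Latin squares of order $6$ in which $\Psi$ is classical.
   Context: A quantum Latin square (QLS) of order $n$ is an $n\times n$ matrix $\Psi=(\psi_{ij})_{1\le i,j\le n}$ whose entries are unit vectors in $\mathbb C^n$ such that the entries of each row and the entries of each column form an orthonormal basis of $\mathbb C^n$. Two QLS $\Psi=(\psi_{ij})$ and $\Phi=(\phi_{ij})$ of order $n$ are orthogonal if $\{\psi_{ij}\otimes\phi_{ij}: 1\le i,j\le n\}$ is an orthonormal basis of $\mathbb C^n\otimes\mathbb C^n$. A single QLS $\Psi$ of order $n$ is classical if there exist an orthonormal basis $e_1,\dots,e_n$ of $\mathbb C^n$ and a Latin square $L=(L_{ij})$ of order $n$ on the symbols $\{1,\dots,n\}$ such that each $\psi_{ij}$ is a scalar multiple of $e_{L_{ij}}$. *)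

theory Defs
  imports Complex_Main
begin

text \<open>Vectors of \<open>\<complex>^d\<close> are represented as functions \<open>nat \<Rightarrow> complex\<close>;
  only the coordinates \<open>k < d\<close> are relevant.\<close>

definition cinner :: "nat \<Rightarrow> (nat \<Rightarrow> complex) \<Rightarrow> (nat \<Rightarrow> complex) \<Rightarrow> complex" where
  "cinner d u v = (\<Sum>k<d. u k * cnj (v k))"

definition is_onb :: "nat \<Rightarrow> 'i set \<Rightarrow> ('i \<Rightarrow> nat \<Rightarrow> complex) \<Rightarrow> bool" where
  "is_onb d I f \<longleftrightarrow> finite I \<and>
     (\<forall>i\<in>I. \<forall>j\<in>I. cinner d (f i) (f j) = (if i = j then 1 else 0)) \<and>
     (\<forall>v. \<exists>c. \<forall>k<d. v k = (\<Sum>i\<in>I. c i * f i k))"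

text \<open>Tensor product \<open>\<complex>^n \<otimes> \<complex>^n \<cong> \<complex>^(n*n)\<close>, coordinate \<open>(a,b)\<close> stored at \<open>a*n+b\<close>.\<close>
definition tensor :: "nat \<Rightarrow> (nat \<Rightarrow> complex) \<Rightarrow> (nat \<Rightarrow> complex) \<Rightarrow> nat \<Rightarrow> complex" where
  "tensor n u v = (\<lambda>k. u (k div n) * v (k mod n))"

definition QLS :: "nat \<Rightarrow> (nat \<Rightarrow> nat \<Rightarrow> nat \<Rightarrow> complex) \<Rightarrow> bool" where
  "QLS n \<Psi> \<longleftrightarrow>
     (\<forall>i<n. \<forall>j<n. cinner n (\<Psi> i j) (\<Psi> i j) = 1) \<and>
     (\<forall>i<n. is_onb n {..<n} (\<lambda>j. \<Psi> i j)) \<and>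
     (\<forall>j<n. is_onb n {..<n} (\<lambda>i. \<Psi> i j))"

definition orthogonal_QLS :: "nat \<Rightarrow> (nat \<Rightarrow> nat \<Rightarrow> nat \<Rightarrow> complex) \<Rightarrow> (nat \<Rightarrow> nat \<Rightarrow> nat \<Rightarrow> complex) \<Rightarrow> bool" where
  "orthogonal_QLS n \<Psi> \<Phi> \<longleftrightarrow>
     is_onb (n * n) ({..<n} \<times> {..<n}) (\<lambda>(i, j). tensor n (\<Psi> i j) (\<Phi> i j))"

definition latin_square :: "nat \<Rightarrow> (nat \<Rightarrow> nat \<Rightarrow> nat) \<Rightarrow> bool" where
  "latin_square n L \<longleftrightarrow>
     (\<forall>i<n. bij_betw (\<lambda>j. L i j) {..<n} {..<n}) \<and>
     (\<forall>j<n. bij_betw (\<lambda>i. L i j) {..<n} {..<n})"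

definition classical_QLS :: "nat \<Rightarrow> (nat \<Rightarrow> nat \<Rightarrow> nat \<Rightarrow> complex) \<Rightarrow> bool" where
  "classical_QLS n \<Psi> \<longleftrightarrow>
     (\<exists>e L. is_onb n {..<n} e \<and> latin_square n L \<and>
        (\<forall>i<n. \<forall>j<n. \<exists>c::complex. \<forall>k<n. \<Psi> i j k = c * e (L i j) k))"

end

theory Submission
  imports Defs "Jordan_Normal_Form.Determinant"
begin

text \<open>
  Orthogonality of \<open>\<Psi>\<close> and \<open>\<Phi>\<close> says that two different cells are orthogonal in \<open>\<Psi>\<close> or in \<open>\<Phi>\<close>.
  Fix two rows. A cell of one row is non-orthogonal to some cells of the other row in \<open>\<Psi>\<close>, and to some
  others in \<open>\<Phi>\<close>; both differ from the cell in its own column, so at most \<open>5\<close> cells are involved.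
  Call the pair of rows sparse for \<open>\<Psi>\<close> if no cell of one row has three non-orthogonal cells in the other.

  Only the zero pattern of the transition matrices between the row bases matters: two rows of a unitary
  matrix cannot overlap in exactly one position, and three rows cannot be supported in two columns. A
  finite analysis of these patterns shows that a pair of rows that is not sparse for \<open>\<Psi>\<close> and a pair that
  is not sparse for \<open>\<Phi>\<close> never share a row. Hence all rows are sparse with respect to row \<open>0\<close>, for \<open>\<Psi>\<close>
  or for \<open>\<Phi>\<close>; say for \<open>\<Psi>\<close>.

  Then each \<open>\<Psi> i j\<close> is a multiple of a vector of row \<open>0\<close> or lies in the plane of two of them, say with
  coordinates \<open>s, t\<close>. Orthogonal vectors of that plane have products \<open>s * cnj t\<close> pointing in opposite
  directions, so choosing the first or the second basis vector according to the half plane containing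
  \<open>s * cnj t\<close> labels the cells such that \<open>\<Psi>\<close>-orthogonal cells get different labels. Replacing each cell by the
  standard basis vector of its label gives a classical square that is still orthogonal to \<open>\<Phi>\<close>.
\<close>

section \<open>Orthonormal bases and orthogonal squares\<close>

lemma cinner_cnj: "cnj (cinner d u v) = cinner d v u"
  by (simp add: cinner_def mult.commute)

lemma cinner_swap_eq_0: "cinner d u v = 0 \<longleftrightarrow> cinner d v u = 0"
  by (metis cinner_cnj complex_cnj_zero_iff)

lemma cmod_cinner_swap: "cmod (cinner d u v) = cmod (cinner d v u)"
  by (subst cinner_cnj[symmetric]) (rule complex_mod_cnj)

lemma cinner_sum_left:
  assumes "\<And>k. k < d \<Longrightarrow> u k = (\<Sum>i\<in>I. c i * f i k)"
  shows "cinner d u v = (\<Sum>i\<in>I. c i * cinner d (f i) v)"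
proof -
  have "cinner d u v = (\<Sum>k<d. \<Sum>i\<in>I. c i * (f i k * cnj (v k)))"
    unfolding cinner_def using assms by (intro sum.cong) (auto simp: sum_distrib_right mult.assoc)
  also have "\<dots> = (\<Sum>i\<in>I. c i * cinner d (f i) v)"
    unfolding cinner_def by (subst sum.swap) (simp add: sum_distrib_left)
  finally show ?thesis .
qed

lemma parseval:
  assumes "is_onb d I f"
  shows "cinner d u v = (\<Sum>i\<in>I. cinner d u (f i) * cinner d (f i) v)"
proof -
  from assms obtain c where c: "\<And>k. k < d \<Longrightarrow> u k = (\<Sum>i\<in>I. c i * f i k)"
    unfolding is_onb_def by meson
  have "cinner d u (f j) = c j" if "j \<in> I" for j
  proof -
    have "cinner d u (f j) = (\<Sum>i\<in>I. c i * cinner d (f i) (f j))"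
      by (rule cinner_sum_left[OF c])
    also have "\<dots> = (\<Sum>i\<in>I. if i = j then c i else 0)"
      using assms that by (intro sum.cong) (auto simp: is_onb_def)
    also have "\<dots> = c j"
      using assms that by (simp add: is_onb_def)
    finally show ?thesis .
  qed
  moreover have "cinner d u v = (\<Sum>i\<in>I. c i * cinner d (f i) v)"
    by (rule cinner_sum_left[OF c])
  ultimately show ?thesis by simp
qed

text \<open>Orthonormality makes \<open>N\<close> a right inverse of the square matrix
  \<open>M\<close>, hence also a left inverse; read entrywise, the latter is the completeness
  relation, which yields the spanning part.\<close>

lemma is_onb_if_orthonormal:
  assumes "finite I" "card I = d"
    and on: "\<And>i j. i \<in> I \<Longrightarrow> j \<in> I \<Longrightarrow> cinner d (f i) (f j) = (if i = j then 1 else 0)"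
  shows "is_onb d I f"
proof -
  obtain h where h: "bij_betw h {..<d} I"
    using ex_bij_betw_nat_finite[OF assms(1)] assms(2) by (auto simp: atLeast0LessThan)
  define M where "M = mat d d (\<lambda>(i, k). f (h i) k)"
  define N where "N = mat d d (\<lambda>(k, i). cnj (f (h i) k))"
  have "M * N = 1\<^sub>m d"
  proof (rule eq_matI)
    fix i j assume "i < dim_row (1\<^sub>m d :: complex mat)" "j < dim_col (1\<^sub>m d :: complex mat)"
    then have ij: "i < d" "j < d" by auto
    then have "(M * N) $$ (i, j) = cinner d (f (h i)) (f (h j))"
      by (simp add: M_def N_def scalar_prod_def cinner_def atLeast0LessThan)
    also have "\<dots> = (1\<^sub>m d :: complex mat) $$ (i, j)"
      using ij h on[of "h i" "h j"] by (auto simp: bij_betw_def inj_on_def)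
    finally show "(M * N) $$ (i, j) = (1\<^sub>m d :: complex mat) $$ (i, j)" .
  qed (auto simp: M_def N_def)
  moreover have "M \<in> carrier_mat d d" "N \<in> carrier_mat d d"
    by (simp_all add: M_def N_def)
  ultimately have NM: "N * M = 1\<^sub>m d"
    by (metis mat_mult_left_right_inverse)
  have resolution: "(\<Sum>i\<in>I. cnj (f i k) * f i l) = (if k = l then 1 else 0)" if "k < d" "l < d" for k l
  proof -
    have "(\<Sum>i\<in>I. cnj (f i k) * f i l) = (\<Sum>i<d. cnj (f (h i) k) * f (h i) l)"
      using sum.reindex_bij_betw[OF h, of "\<lambda>i. cnj (f i k) * f i l"] by simp
    also have "\<dots> = (N * M) $$ (k, l)"
      using that by (simp add: M_def N_def scalar_prod_def atLeast0LessThan)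
    finally show ?thesis
      using NM that by simp
  qed
  have "v l = (\<Sum>i\<in>I. cinner d v (f i) * f i l)" if "l < d" for v l
  proof -
    have "(\<Sum>i\<in>I. cinner d v (f i) * f i l) = (\<Sum>i\<in>I. \<Sum>k<d. v k * (cnj (f i k) * f i l))"
      by (simp add: cinner_def sum_distrib_right mult.assoc)
    also have "\<dots> = (\<Sum>k<d. v k * (\<Sum>i\<in>I. cnj (f i k) * f i l))"
      by (subst sum.swap) (simp add: sum_distrib_left)
    also have "\<dots> = (\<Sum>k<d. if k = l then v k else 0)"
      using that by (intro sum.cong) (auto simp: resolution)
    finally show ?thesis
      using that by simp
  qed
  then show ?thesis
    using assms(1) on unfolding is_onb_def by metis
qed

lemma cinner_tensor: "cinner (n * n) (tensor n u v) (tensor n u' v') = cinner n u u' * cinner n v v'"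
proof -
  have "cinner (n * n) (tensor n u v) (tensor n u' v') =
      (\<Sum>(a, b)\<in>{..<n} \<times> {..<n}. (u a * cnj (u' a)) * (v b * cnj (v' b)))"
    unfolding cinner_def tensor_def
  proof (rule sum.reindex_bij_witness[where i = "\<lambda>(a, b). a * n + b" and j = "\<lambda>k. (k div n, k mod n)"])
    fix p assume "p \<in> {..<n} \<times> {..<n}"
    then obtain a b where p: "p = (a, b)" "a < n" "b < n" by auto
    then have "a * n + b < (a + 1) * n" by simp
    also have "\<dots> \<le> n * n" using p by (intro mult_right_mono) auto
    finally show "(case p of (a, b) \<Rightarrow> a * n + b) \<in> {..<n * n}" using p by simp
  next
    fix k assume k: "k \<in> {..<n * n}"
    then have "0 < n" by (cases n) auto
    then show "(k div n, k mod n) \<in> {..<n} \<times> {..<n}"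
      using k by (auto simp: less_mult_imp_div_less)
  qed (auto simp: mult_ac)
  also have "\<dots> = cinner n u u' * cinner n v v'"
    by (simp add: cinner_def sum_product sum.cartesian_product)
  finally show ?thesis .
qed

text \<open>Inner products of tensors multiply, and \<open>n * n\<close> orthonormal vectors span
  automatically.\<close>

lemma orthogonal_QLS_iff:
  assumes "QLS n \<Psi>" "QLS n \<Phi>"
  shows "orthogonal_QLS n \<Psi> \<Phi> \<longleftrightarrow>
    (\<forall>i<n. \<forall>j<n. \<forall>k<n. \<forall>l<n. (i, j) \<noteq> (k, l) \<longrightarrow>
      cinner n (\<Psi> i j) (\<Psi> k l) = 0 \<or> cinner n (\<Phi> i j) (\<Phi> k l) = 0)"
    (is "_ \<longleftrightarrow> ?R")
proof
  assume "orthogonal_QLS n \<Psi> \<Phi>"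
  then have "cinner (n * n) (tensor n (\<Psi> i j) (\<Phi> i j)) (tensor n (\<Psi> k l) (\<Phi> k l)) = (if (i, j) = (k, l) then 1 else 0)"
    if "i < n" "j < n" "k < n" "l < n" for i j k l
    using that unfolding orthogonal_QLS_def is_onb_def by force
  then show ?R
    unfolding cinner_tensor by (metis mult_eq_0_iff)
next
  assume R: ?R
  show "orthogonal_QLS n \<Psi> \<Phi>"
    unfolding orthogonal_QLS_def
  proof (rule is_onb_if_orthonormal)
    fix p q assume "p \<in> {..<n} \<times> {..<n}" "q \<in> {..<n} \<times> {..<n}"
    then obtain i j k l where "p = (i, j)" "q = (k, l)" "i < n" "j < n" "k < n" "l < n" by auto
    then show "cinner (n * n) (case p of (i, j) \<Rightarrow> tensor n (\<Psi> i j) (\<Phi> i j)) (case q of (i, j) \<Rightarrow> tensor n (\<Psi> i j) (\<Phi> i j)) =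
        (if p = q then 1 else 0)"
      using R assms by (auto simp: cinner_tensor QLS_def)
  qed auto
qed

section \<open>Sparse squares have classical mates\<close>

definition nonorth :: "nat \<Rightarrow> (nat \<Rightarrow> nat \<Rightarrow> nat \<Rightarrow> complex) \<Rightarrow> nat \<Rightarrow> nat \<Rightarrow> nat \<Rightarrow> nat \<Rightarrow> bool" where
  "nonorth n \<Psi> i j k l \<longleftrightarrow> i < n \<and> j < n \<and> k < n \<and> l < n \<and> cinner n (\<Psi> i j) (\<Psi> k l) \<noteq> 0"

definition sparse :: "(nat \<Rightarrow> nat \<Rightarrow> nat \<Rightarrow> nat \<Rightarrow> bool) \<Rightarrow> nat \<Rightarrow> nat \<Rightarrow> bool" where
  "sparse A i k \<longleftrightarrow> (\<forall>j x y z. A i j k x \<longrightarrow> A i j k y \<longrightarrow> A i j k z \<longrightarrow> x = y \<or> x = z \<or> y = z)"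

lemma sparseD: "sparse A i k \<Longrightarrow> A i j k x \<Longrightarrow> A i j k y \<Longrightarrow> A i j k z \<Longrightarrow> x = y \<or> x = z \<or> y = z"
  by (simp add: sparse_def)

text \<open>The open right half plane with the upper half of its boundary line added, so that it
  contains exactly one of \<open>z\<close> and \<open>- z\<close> for every nonzero
  \<open>z\<close>.\<close>

definition upper :: "complex \<Rightarrow> bool" where
  "upper z \<longleftrightarrow> Re z > 0 \<or> Re z = 0 \<and> Im z > 0"

lemma upper_opposite:
  assumes "z * of_real a = - (w * of_real b)" "a > 0" "b > 0" "z \<noteq> 0"
  shows "upper z \<noteq> upper w"
proof -
  define c where "c = b / a"
  have c: "c > 0" using assms by (simp add: c_def)
  have "Re z * a = - (Re w * b)" "Im z * a = - (Im w * b)"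
    using arg_cong[OF assms(1), of Re] arg_cong[OF assms(1), of Im] by simp_all
  then have z: "Re z = - (Re w * c)" "Im z = - (Im w * c)"
    using assms(2) by (simp_all add: c_def field_simps)
  have "Re w \<noteq> 0 \<or> Im w \<noteq> 0"
    using z assms(4) by (auto simp: complex_eq_iff)
  with c show ?thesis
    unfolding upper_def z by (auto simp: mult_less_0_iff)
qed

section \<open>Parseval's identity and non-orthogonal cells\<close>

lemma is_onb_row: "QLS n \<Psi> \<Longrightarrow> k < n \<Longrightarrow> is_onb n {..<n} (\<lambda>l. \<Psi> k l)"
  by (simp add: QLS_def)

lemma QLS_row: "QLS n \<Psi> \<Longrightarrow> i < n \<Longrightarrow> j < n \<Longrightarrow> l < n \<Longrightarrow> cinner n (\<Psi> i j) (\<Psi> i l) = (if j = l then 1 else 0)"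
  by (simp add: QLS_def is_onb_def)

lemma QLS_column: "QLS n \<Psi> \<Longrightarrow> i < n \<Longrightarrow> k < n \<Longrightarrow> j < n \<Longrightarrow> cinner n (\<Psi> i j) (\<Psi> k j) = (if i = k then 1 else 0)"
  by (simp add: QLS_def is_onb_def)

lemma nonorth_sym: "nonorth n \<Psi> i j k l \<Longrightarrow> nonorth n \<Psi> k l i j"
  by (auto simp: nonorth_def cinner_swap_eq_0)

text \<open>The Parseval sum over row \<open>r\<close> is nonzero, so one of its terms is.\<close>

lemma nonorth_via:
  assumes "QLS n \<Psi>" "r < n" "nonorth n \<Psi> i j k l"
  shows "\<exists>m. nonorth n \<Psi> i j r m \<and> nonorth n \<Psi> r m k l"
proof (rule ccontr)
  assume "\<nexists>m. nonorth n \<Psi> i j r m \<and> nonorth n \<Psi> r m k l"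
  then have "cinner n (\<Psi> i j) (\<Psi> r m) * cinner n (\<Psi> r m) (\<Psi> k l) = 0" if "m < n" for m
    using assms that by (auto simp: nonorth_def)
  then have "cinner n (\<Psi> i j) (\<Psi> k l) = 0"
    by (subst parseval[OF is_onb_row[OF assms(1,2)]]) (simp add: sum.neutral)
  then show False
    using assms(3) by (simp add: nonorth_def)
qed

text \<open>The Parseval sum over row \<open>r\<close> has a single nonzero term, which nothing can
  cancel.\<close>

lemma nonorth_single:
  assumes "QLS n \<Psi>" "nonorth n \<Psi> i j r m" "nonorth n \<Psi> k l r m"
    and "\<And>m'. nonorth n \<Psi> i j r m' \<Longrightarrow> nonorth n \<Psi> k l r m' \<Longrightarrow> m' = m"
  shows "nonorth n \<Psi> i j k l"
proof -
  have r: "r < n" "m < n" using assms(2) by (simp_all add: nonorth_def)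
  have "cinner n (\<Psi> i j) (\<Psi> k l) = (\<Sum>m'<n. cinner n (\<Psi> i j) (\<Psi> r m') * cinner n (\<Psi> r m') (\<Psi> k l))"
    by (rule parseval[OF is_onb_row[OF assms(1) r(1)]])
  also have "\<dots> = (\<Sum>m'<n. if m' = m then cinner n (\<Psi> i j) (\<Psi> r m) * cinner n (\<Psi> r m) (\<Psi> k l) else 0)"
    using assms(2-4) by (intro sum.cong) (auto simp: nonorth_def cinner_swap_eq_0[of n "\<Psi> r _"])
  also have "\<dots> = cinner n (\<Psi> i j) (\<Psi> r m) * cinner n (\<Psi> r m) (\<Psi> k l)"
    using r by simp
  also have "\<dots> \<noteq> 0"
    using assms(2,3) by (auto simp: nonorth_def cinner_swap_eq_0[of n "\<Psi> r _"])
  finally show ?thesis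
    using assms(2,3) by (simp add: nonorth_def)
qed

lemma sum_norm_row:
  assumes "QLS n \<Psi>" "i < n" "j < n" "k < n"
  shows "(\<Sum>l<n. (cmod (cinner n (\<Psi> i j) (\<Psi> k l)))\<^sup>2) = 1"
proof -
  have "complex_of_real (\<Sum>l<n. (cmod (cinner n (\<Psi> i j) (\<Psi> k l)))\<^sup>2) =
      (\<Sum>l<n. cinner n (\<Psi> i j) (\<Psi> k l) * cinner n (\<Psi> k l) (\<Psi> i j))"
    unfolding of_real_sum by (intro sum.cong) (simp_all only: complex_norm_square cinner_cnj)
  also have "\<dots> = cinner n (\<Psi> i j) (\<Psi> i j)"
    by (rule parseval[OF is_onb_row[OF assms(1,4)], symmetric])
  also have "\<dots> = 1"
    using assms by (simp add: QLS_row)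
  finally show ?thesis
    by (simp only: of_real_eq_1_iff)
qed

text \<open>Double counting of the squared moduli \<open>w\<close>: three rows of the transition
  matrix supported in the columns \<open>x\<close> and \<open>y\<close> would put total weight 3
  there, but each column holds at most 1.\<close>

lemma nonorth_three_in_two:
  assumes Q: "QLS n \<Psi>" and i: "i < n" "k < n" and j: "distinct [j1, j2, j3]" "j1 < n" "j2 < n" "j3 < n"
    and x: "x < n" "y < n" "x \<noteq> y"
  shows "\<exists>z. z \<noteq> x \<and> z \<noteq> y \<and> (nonorth n \<Psi> i j1 k z \<or> nonorth n \<Psi> i j2 k z \<or> nonorth n \<Psi> i j3 k z)"
proof (rule ccontr)
  assume none: "\<nexists>z. z \<noteq> x \<and> z \<noteq> y \<and> (nonorth n \<Psi> i j1 k z \<or> nonorth n \<Psi> i j2 k z \<or> nonorth n \<Psi> i j3 k z)"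
  define w where "w j l = (cmod (cinner n (\<Psi> i j) (\<Psi> k l)))\<^sup>2" for j l
  have row: "w j x + w j y = 1" if "j \<in> {j1, j2, j3}" for j
  proof -
    have "1 = (\<Sum>l<n. w j l)"
      unfolding w_def using that j i by (intro sum_norm_row[OF Q, symmetric]) auto
    also have "\<dots> = (\<Sum>l\<in>{x, y}. w j l)"
      using that none i j x by (intro sum.mono_neutral_right) (auto simp: w_def nonorth_def)
    finally show ?thesis using x by simp
  qed
  have column: "w j1 l + w j2 l + w j3 l \<le> 1" if "l < n" for l
  proof -
    have "w j1 l + w j2 l + w j3 l = (\<Sum>j\<in>{j1, j2, j3}. w j l)"
      using j(1) by (simp add: add.assoc)
    also have "\<dots> \<le> (\<Sum>j<n. w j l)"
      using j by (intro sum_mono2) (auto simp: w_def)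
    also have "\<dots> = (\<Sum>j<n. (cmod (cinner n (\<Psi> k l) (\<Psi> i j)))\<^sup>2)"
      unfolding w_def by (intro sum.cong refl) (simp only: cmod_cinner_swap)
    also have "\<dots> = 1"
      using i that by (intro sum_norm_row[OF Q]) auto
    finally show ?thesis .
  qed
  have "w j1 x + w j1 y = 1" "w j2 x + w j2 y = 1" "w j3 x + w j3 y = 1"
    by (rule row; simp)+
  then show False
    using column[OF x(1)] column[OF x(2)] by linarith
qed

lemma classical_mate_if_sparse:
  assumes Q: "QLS n \<Psi>" "QLS n \<Phi>" and orth: "orthogonal_QLS n \<Psi> \<Phi>" and n: "0 < n"
    and sparse: "\<And>i. i < n \<Longrightarrow> sparse (nonorth n \<Psi>) i 0"
  shows "\<exists>\<Psi>'. QLS n \<Psi>' \<and> orthogonal_QLS n \<Psi>' \<Phi> \<and> classical_QLS n \<Psi>'"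
proof -
  define T where "T i j = {x. nonorth n \<Psi> i j 0 x}" for i j
  define a where "a i j x = cinner n (\<Psi> i j) (\<Psi> 0 x)" for i j x
  define r where "r i j = a i j (Min (T i j)) * cnj (a i j (Max (T i j)))" for i j
  \<comment> \<open>If \<open>T i j\<close> is a singleton, \<open>Min\<close> and
    \<open>Max\<close> agree and \<open>r\<close> has no influence on the label.\<close>
  define L where "L i j = (if upper (r i j) then Min (T i j) else Max (T i j))" for i j
  have fin: "finite (T i j)" for i j
    by (rule finite_subset[of _ "{..<n}"]) (auto simp: T_def nonorth_def)
  have nonempty: "T i j \<noteq> {}" if "i < n" "j < n" for i j
  proof -
    have "nonorth n \<Psi> i j i j"
      using Q(1) that by (simp add: nonorth_def QLS_row)
    from nonorth_via[OF Q(1) n this] show ?thesis by (auto simp: T_def)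
  qed
  have L_T: "L i j \<in> T i j" if "i < n" "j < n" for i j
    using fin nonempty[OF that] by (simp add: L_def)
  have L_neq: "L i j \<noteq> L k l" if ij: "i < n" "j < n" "k < n" "l < n" and ortho: "cinner n (\<Psi> i j) (\<Psi> k l) = 0" for i j k l
  proof
    assume eq: "L i j = L k l"
    define x where "x = L i j"
    have x: "x \<in> T i j" "x \<in> T k l"
      using L_T[OF ij(1,2)] L_T[OF ij(3,4)] eq by (simp_all add: x_def)
    have "\<not> nonorth n \<Psi> i j k l"
      using ortho by (simp add: nonorth_def)
    \<comment> \<open>A single common label would make the two cells non-orthogonal. Given a second
      one, sparseness leaves no room for further labels in either support.\<close>
    then obtain y where y: "y \<noteq> x" "y \<in> T i j" "y \<in> T k l"
      using nonorth_single[OF Q(1), of i j 0 x k l] x unfolding T_def mem_Collect_eq by metis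
    have T: "T i j = {x, y}" "T k l = {x, y}"
      using x y sparseD[OF sparse[OF ij(1)]] sparseD[OF sparse[OF ij(3)]]
      unfolding T_def set_eq_iff mem_Collect_eq insert_iff empty_iff by metis+
    define p where "p = Min {x, y}"
    define q where "q = Max {x, y}"
    have pq: "{p, q} = {x, y}" "p \<noteq> q"
      using y(1) by (auto simp: p_def q_def min_def max_def)
    then have in_T: "p \<in> T i j" "q \<in> T i j" "p \<in> T k l" "q \<in> T k l"
      by (auto simp: T)
    then have range: "p < n" "q < n" and nz: "a i j p \<noteq> 0" "a i j q \<noteq> 0" "a k l p \<noteq> 0" "a k l q \<noteq> 0"
      by (auto simp: T_def nonorth_def a_def)
    have r: "r i j = a i j p * cnj (a i j q)" "r k l = a k l p * cnj (a k l q)"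
      by (simp_all add: r_def T p_def q_def)
    have "0 = (\<Sum>t<n. a i j t * cnj (a k l t))"
      using ortho unfolding a_def cinner_cnj by (subst parseval[OF is_onb_row[OF Q(1) n], symmetric]) simp
    also have "\<dots> = (\<Sum>t\<in>{p, q}. a i j t * cnj (a k l t))"
    proof (intro sum.mono_neutral_right ballI)
      fix t assume "t \<in> {..<n} - {p, q}"
      then have "t \<notin> T i j" "t < n" using T pq by auto
      then show "a i j t * cnj (a k l t) = 0"
        using ij n by (auto simp: T_def a_def nonorth_def)
    qed (use range in auto)
    also have "\<dots> = a i j p * cnj (a k l p) + a i j q * cnj (a k l q)"
      using pq(2) by simp
    finally have zero: "a i j p * cnj (a k l p) = - (a i j q * cnj (a k l q))"
      by (simp add: eq_neg_iff_add_eq_0)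
    \<comment> \<open>Multiplying \<open>zero\<close> by \<open>cnj (a i j q) * a k l p\<close>
      shows that \<open>r i j\<close> is a negative multiple of \<open>r k l\<close>.\<close>
    have "r i j * of_real ((cmod (a k l p))\<^sup>2) = (a i j p * cnj (a k l p)) * cnj (a i j q) * a k l p"
      by (simp add: r complex_norm_square mult_ac del: of_real_power)
    also have "\<dots> = - (r k l * of_real ((cmod (a i j q))\<^sup>2))"
      unfolding zero by (simp add: r complex_norm_square mult_ac del: of_real_power)
    finally have "upper (r i j) \<noteq> upper (r k l)"
      using nz by (intro upper_opposite[where a = "(cmod (a k l p))\<^sup>2" and b = "(cmod (a i j q))\<^sup>2"]) (auto simp: r)
    moreover have "L i j = (if upper (r i j) then p else q)" "L k l = (if upper (r k l) then p else q)"
      by (simp_all only: L_def T p_def q_def)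
    ultimately show False
      using eq pq(2) by (simp split: if_splits)
  qed
  have L_less: "L i j < n" if "i < n" "j < n" for i j
    using L_T[OF that] by (simp add: T_def nonorth_def)
  have rows: "inj_on (\<lambda>j. L i j) {..<n}" if "i < n" for i
    using that L_neq[of i _ i] Q(1) by (intro inj_onI) (metis QLS_row lessThan_iff)
  have columns: "inj_on (\<lambda>i. L i j) {..<n}" if "j < n" for j
    using that L_neq[of _ j _ j] Q(1) by (intro inj_onI) (metis QLS_column lessThan_iff)
  define e :: "nat \<Rightarrow> nat \<Rightarrow> complex" where "e s k = (if k = s then 1 else 0)" for s k
  have e: "cinner n (e s) (e t) = (if s = t then 1 else 0)" if "s < n" "t < n" for s t
  proof -
    have "cinner n (e s) (e t) = (\<Sum>k<n. if k = s then (if s = t then 1 else 0) else 0)"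
      unfolding cinner_def by (intro sum.cong) (auto simp: e_def)
    then show ?thesis using that by simp
  qed
  define \<Psi>' where "\<Psi>' i j = e (L i j)" for i j
  have inner: "cinner n (\<Psi>' i j) (\<Psi>' k l) = (if L i j = L k l then 1 else 0)" if "i < n" "j < n" "k < n" "l < n" for i j k l
    using that L_less by (simp add: \<Psi>'_def e)
  have Q': "QLS n \<Psi>'"
    unfolding QLS_def
  proof (intro conjI allI impI is_onb_if_orthonormal)
    fix i j l assume "i < n" "j \<in> {..<n}" "l \<in> {..<n}"
    then show "cinner n (\<Psi>' i j) (\<Psi>' i l) = (if j = l then 1 else 0)"
      using rows[of i] by (auto simp: inner inj_on_def)
  next
    fix j i k assume "j < n" "i \<in> {..<n}" "k \<in> {..<n}"
    then show "cinner n (\<Psi>' i j) (\<Psi>' k j) = (if i = k then 1 else 0)"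
      using columns[of j] by (auto simp: inner inj_on_def)
  qed (auto simp: inner)
  moreover have "orthogonal_QLS n \<Psi>' \<Phi>"
    unfolding orthogonal_QLS_iff[OF Q' Q(2)]
  proof (intro allI impI)
    fix i j k l assume ij: "i < n" "j < n" "k < n" "l < n" and neq: "(i, j) \<noteq> (k, l)"
    from ij neq have "cinner n (\<Psi> i j) (\<Psi> k l) = 0 \<or> cinner n (\<Phi> i j) (\<Phi> k l) = 0"
      using orth[unfolded orthogonal_QLS_iff[OF Q]] by blast
    then show "cinner n (\<Psi>' i j) (\<Psi>' k l) = 0 \<or> cinner n (\<Phi> i j) (\<Phi> k l) = 0"
      using L_neq[OF ij] by (auto simp: inner ij)
  qed
  moreover have "classical_QLS n \<Psi>'"
    unfolding classical_QLS_def
  proof (intro exI conjI)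
    show "is_onb n {..<n} e"
      using e by (intro is_onb_if_orthonormal) auto
    show "latin_square n L"
      unfolding latin_square_def bij_betw_def
      by (intro conjI allI impI endo_inj_surj rows columns) (auto simp: L_less)
    show "\<forall>i<n. \<forall>j<n. \<exists>c. \<forall>k<n. \<Psi>' i j k = c * e (L i j) k"
      by (auto simp: \<Psi>'_def intro!: exI[of _ 1])
  qed
  ultimately show ?thesis by blast
qed
section \<open>Zero patterns of unitary matrices of size six\<close>

text \<open>The index set is a list so that conditions on unordered pairs and triples of indices are stated
  once (\<open>sorted_wrt\<close>, \<open>triplewise\<close>); this keeps the propositional problems below small.\<close>

fun triplewise :: "('a \<Rightarrow> 'a \<Rightarrow> 'a \<Rightarrow> bool) \<Rightarrow> 'a list \<Rightarrow> bool" where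
  "triplewise P [] \<longleftrightarrow> True"
| "triplewise P (x # xs) \<longleftrightarrow> sorted_wrt (P x) xs \<and> triplewise P xs"

lemma sorted_wrt_if_distinct:
  assumes "distinct xs" "\<And>x y. x \<in> set xs \<Longrightarrow> y \<in> set xs \<Longrightarrow> x \<noteq> y \<Longrightarrow> P x y"
  shows "sorted_wrt P xs"
  using assms by (induction xs) auto

lemma triplewise_if_distinct:
  assumes "distinct xs"
    and "\<And>x y z. x \<in> set xs \<Longrightarrow> y \<in> set xs \<Longrightarrow> z \<in> set xs \<Longrightarrow> x \<noteq> y \<Longrightarrow> x \<noteq> z \<Longrightarrow> y \<noteq> z \<Longrightarrow> P x y z"
  shows "triplewise P xs"
  using assms
proof (induction xs)
  case (Cons a xs)
  have "sorted_wrt (P a) xs"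
    using Cons.prems by (intro sorted_wrt_if_distinct) auto
  moreover have "triplewise P xs"
    using Cons.prems by (intro Cons.IH) auto
  ultimately show ?case by simp
qed simp

lemma sorted_wrtD:
  assumes "sorted_wrt P xs" "x \<in> set xs" "y \<in> set xs" "x \<noteq> y" "\<And>x y. P x y \<Longrightarrow> P y x"
  shows "P x y"
  using assms by (induction xs) auto

lemma triplewiseD:
  assumes "triplewise P xs" "x \<in> set xs" "y \<in> set xs" "z \<in> set xs" "x \<noteq> y" "x \<noteq> z" "y \<noteq> z"
    and "\<And>x y z. P x y z \<Longrightarrow> P y x z" "\<And>x y z. P x y z \<Longrightarrow> P x z y"
  shows "P x y z"
  using assms(1-7)
proof (induction xs)
  case (Cons a xs)
  have a: "P a b c" if "b \<in> set xs" "c \<in> set xs" "b \<noteq> c" for b c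
    using _ that
  proof (rule sorted_wrtD)
    show "sorted_wrt (P a) xs" using Cons.prems(1) by simp
  qed (rule assms(9))
  consider "x = a" | "y = a" | "z = a" | "a \<notin> {x, y, z}" by blast
  then show ?case
  proof cases
    case 1
    then show ?thesis using a[of y z] Cons.prems by simp
  next
    case 2
    then show ?thesis using assms(8)[OF a[of x z]] Cons.prems by simp
  next
    case 3
    then show ?thesis using assms(9)[OF assms(8)[OF a[of x y]]] Cons.prems by simp
  next
    case 4
    then show ?thesis using Cons.prems by (intro Cons.IH) auto
  qed
qed simp

text \<open>Necessary conditions on the zero pattern of a unitary matrix: no row vanishes, and the
  inner product of two rows cannot have exactly one nonzero term.\<close>

definition coherent :: "'a list \<Rightarrow> ('a \<Rightarrow> 'a \<Rightarrow> bool) \<Rightarrow> bool" where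
  "coherent S U \<longleftrightarrow> (\<forall>i\<in>set S. \<exists>x\<in>set S. U i x) \<and>
     sorted_wrt (\<lambda>i k. \<forall>x\<in>set S. U i x \<and> U k x \<longrightarrow> (\<exists>y\<in>set S. y \<noteq> x \<and> U i y \<and> U k y)) S"

definition no_three_in_two :: "'a list \<Rightarrow> ('a \<Rightarrow> 'a \<Rightarrow> bool) \<Rightarrow> bool" where
  "no_three_in_two S U \<longleftrightarrow> triplewise (\<lambda>i j k.
     sorted_wrt (\<lambda>x y. \<exists>z\<in>set S. z \<noteq> x \<and> z \<noteq> y \<and> (U i z \<or> U j z \<or> U k z)) S) S"

definition sparse_on :: "'a list \<Rightarrow> ('a \<Rightarrow> 'a \<Rightarrow> bool) \<Rightarrow> bool" where
  "sparse_on S U \<longleftrightarrow> (\<forall>i\<in>set S. triplewise (\<lambda>x y z. \<not> (U i x \<and> U i y \<and> U i z)) S)"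

text \<open>The Boolean shadow of a matrix product: the transition between two row bases factors
  through the basis of a third row.\<close>

definition factors_on :: "'a list \<Rightarrow> ('a \<Rightarrow> 'a \<Rightarrow> bool) \<Rightarrow> ('a \<Rightarrow> 'a \<Rightarrow> bool) \<Rightarrow> ('a \<Rightarrow> 'a \<Rightarrow> bool) \<Rightarrow> bool" where
  "factors_on S U V W \<longleftrightarrow> (\<forall>i\<in>set S. \<forall>k\<in>set S. U i k \<longrightarrow> (\<exists>y\<in>set S. V i y \<and> W y k))"

text \<open>The diagonal vanishes because cells of one column are orthogonal; the rest is the
  orthogonality of the two squares.\<close>

definition exclusive_on :: "'a list \<Rightarrow> ('a \<Rightarrow> 'a \<Rightarrow> bool) \<Rightarrow> ('a \<Rightarrow> 'a \<Rightarrow> bool) \<Rightarrow> bool" where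
  "exclusive_on S U V \<longleftrightarrow> (\<forall>i\<in>set S. \<not> U i i \<and> \<not> V i i) \<and> (\<forall>i\<in>set S. \<forall>j\<in>set S. \<not> (U i j \<and> V i j))"

lemmas ground_simps = sorted_wrt.simps triplewise.simps list.set ball_simps bex_simps simp_thms
  coherent_def no_three_in_two_def sparse_on_def factors_on_def exclusive_on_def

lemma distinct_six:
  assumes "distinct [c0, c1, c2, c3, c4, c5]"
  shows "c0 \<noteq> c1" "c0 \<noteq> c2" "c0 \<noteq> c3" "c0 \<noteq> c4" "c0 \<noteq> c5" "c1 \<noteq> c2" "c1 \<noteq> c3" "c1 \<noteq> c4"
    "c1 \<noteq> c5" "c2 \<noteq> c3" "c2 \<noteq> c4" "c2 \<noteq> c5" "c3 \<noteq> c4" "c3 \<noteq> c5" "c4 \<noteq> c5"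
  using assms by auto

declare [[argo_timeout = 600.0]]

text \<open>\<open>U\<close> and \<open>V\<close> are the zero patterns of the transition matrices between two rows.\<close>

lemma two_rows:
  fixes U V :: "'a \<Rightarrow> 'a \<Rightarrow> bool"
  assumes d: "distinct [c0, c1, c2, c3, c4, c5]" and S: "S = [c0, c1, c2, c3, c4, c5]"
    and facts: "exclusive_on S U V" "coherent S U" "coherent S (\<lambda>i j. U j i)"
      "coherent S V" "coherent S (\<lambda>i j. V j i)" "no_three_in_two S U" "no_three_in_two S V"
    and dense: "U c0 c1" "U c0 c2" "U c0 c3"
  shows "sparse_on S V"
proof -
  note ne = distinct_six[OF d]
  \<comment> \<open>With the six labels explicit, all quantifiers become finite and a propositional
    problem remains.\<close>
  note sim = S ne ne[symmetric] ground_simps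
  note ex = facts(1)[simplified sim]
  note facts' = facts[simplified sim ex]
  show ?thesis unfolding sim using ex facts' dense by argo
qed

text \<open>The indices 0, 1, 2 name three rows, \<open>U\<close> and \<open>V\<close> the patterns
  of the two squares. In terms of row 2, the cells \<open>P\<close> of row 0 span the plane of
  \<open>c0, c1\<close> and the cells \<open>Q\<close> of row 1 that of \<open>c1, c2\<close>;
  \<open>PQ\<close> lists their positions up to relabelling. Each position is a propositional
  problem.\<close>

lemma three_rows:
  fixes U01 U02 U12 V01 V02 V12 :: "'a \<Rightarrow> 'a \<Rightarrow> bool"
  assumes d: "distinct [c0, c1, c2, c3, c4, c5]" and S: "S = [c0, c1, c2, c3, c4, c5]"
    and exclusive: "exclusive_on S U01 V01" "exclusive_on S U02 V02" "exclusive_on S U12 V12"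
    and sparse: "sparse_on S U02" "sparse_on S (\<lambda>i j. U02 j i)" "sparse_on S U12" "sparse_on S (\<lambda>i j. U12 j i)"
      "sparse_on S V01" "sparse_on S (\<lambda>i j. V01 j i)"
    and coherent: "coherent S (\<lambda>i j. U02 j i)" "coherent S (\<lambda>i j. U12 j i)" "coherent S (\<lambda>i j. V01 j i)"
      "coherent S (\<lambda>i j. V02 j i)" "coherent S V12"
    and factors: "factors_on S U02 U01 U12" "factors_on S U12 (\<lambda>i j. U01 j i) U02"
      "factors_on S V01 V02 (\<lambda>i j. V12 j i)" "factors_on S V02 V01 V12" "factors_on S V12 (\<lambda>i j. V01 j i) V02"
    and P: "\<forall>x\<in>P. U02 x c0 \<and> U02 x c1 \<and> (\<forall>y\<in>Q. U01 x y)" and Q: "\<forall>y\<in>Q. U12 y c1 \<and> U12 y c2"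
    and PQ: "P = {c2, c3} \<and> Q = {c0, c4} \<or> P = {c2, c3} \<and> Q = {c4, c5} \<or> P = {c3, c4} \<and> Q = {c0, c5}"
  shows "sparse_on S V02"
proof -
  note ne = distinct_six[OF d]
  note sim = S ne ne[symmetric] ground_simps
  note ex = exclusive[simplified sim]
  from PQ consider "P = {c2, c3}" "Q = {c0, c4}" | "P = {c2, c3}" "Q = {c4, c5}" | "P = {c3, c4}" "Q = {c0, c5}"
    by blast
  then show ?thesis
  proof cases
    case 1
    note cf = P[unfolded 1, simplified ground_simps] Q[unfolded 1, simplified ground_simps]
    note facts = sparse[simplified sim ex cf] coherent[simplified sim ex cf] factors[simplified sim ex cf]
    show ?thesis unfolding sim using ex cf facts by argo
  next
    case 2
    note cf = P[unfolded 2, simplified ground_simps] Q[unfolded 2, simplified ground_simps]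
    note facts = sparse[simplified sim ex cf] coherent[simplified sim ex cf] factors[simplified sim ex cf]
    show ?thesis unfolding sim using ex cf facts by argo
  next
    case 3
    note cf = P[unfolded 3, simplified ground_simps] Q[unfolded 3, simplified ground_simps]
    note facts = sparse[simplified sim ex cf] coherent[simplified sim ex cf] factors[simplified sim ex cf]
    show ?thesis unfolding sim using ex cf facts by argo
  qed
qed
section \<open>Rows that are not sparse\<close>

text \<open>\<open>A i j k l\<close> abstracts non-orthogonality of the cells \<open>(i, j)\<close>
  and \<open>(k, l)\<close> of one square. The assumptions \<open>via\<close> and
  \<open>single\<close> are the traces that Parseval's identity leaves in the zero patterns, and
  \<open>three_in_two\<close> comes from counting norms.\<close>

locale nonorthogonality =
  fixes A :: "nat \<Rightarrow> nat \<Rightarrow> nat \<Rightarrow> nat \<Rightarrow> bool"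
  assumes less_six: "A i j k l \<Longrightarrow> i < 6 \<and> j < 6 \<and> k < 6 \<and> l < 6"
    and sym: "A i j k l \<Longrightarrow> A k l i j"
    and same_row: "i < 6 \<Longrightarrow> j < 6 \<Longrightarrow> A i j i l \<longleftrightarrow> j = l"
    and via: "r < 6 \<Longrightarrow> A i j k l \<Longrightarrow> \<exists>m. A i j r m \<and> A r m k l"
    and single: "A i j r m \<Longrightarrow> A k l r m \<Longrightarrow> (\<And>m'. A i j r m' \<Longrightarrow> A k l r m' \<Longrightarrow> m' = m) \<Longrightarrow> A i j k l"
    and three_in_two: "i < 6 \<Longrightarrow> k < 6 \<Longrightarrow> distinct [j1, j2, j3] \<Longrightarrow> j1 < 6 \<Longrightarrow> j2 < 6 \<Longrightarrow> j3 < 6 \<Longrightarrow>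
      x < 6 \<Longrightarrow> y < 6 \<Longrightarrow> x \<noteq> y \<Longrightarrow> \<exists>z. z \<noteq> x \<and> z \<noteq> y \<and> (A i j1 k z \<or> A i j2 k z \<or> A i j3 k z)"
begin

lemma sym_iff: "A i j k l \<longleftrightarrow> A k l i j"
  using sym by blast

lemma nonempty: "i < 6 \<Longrightarrow> j < 6 \<Longrightarrow> r < 6 \<Longrightarrow> \<exists>m. A i j r m"
  using via same_row by blast

text \<open>A unique common \<open>m\<close> would relate the two cells by \<open>single\<close>,
  against \<open>same_row\<close>.\<close>

lemma overlap:
  assumes "j \<noteq> j'" "A i j k m" "A i j' k m"
  shows "\<exists>m'. m' \<noteq> m \<and> A i j k m' \<and> A i j' k m'"
  using assms single[of i j k m i j'] same_row less_six by metis

text \<open>Suppose cell \<open>l\<close> of row \<open>k\<close> meets \<open>x, y, z\<close> in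
  row \<open>i\<close>. By \<open>overlap\<close>, \<open>x\<close> shares a second cell
  \<open>m\<close> with \<open>y\<close> and \<open>m'\<close> with \<open>z\<close>; sparseness at
  \<open>x\<close> forces \<open>m = m'\<close>. Then \<open>x, y, z\<close> are confined to the
  columns \<open>l, m\<close>, against \<open>three_in_two\<close>.\<close>

lemma sparse_swap:
  assumes "sparse A i k"
  shows "sparse A k i"
  unfolding sparse_def
proof (intro allI impI, rule ccontr)
  fix l x y z
  assume A: "A k l i x" "A k l i y" "A k l i z" and "\<not> (x = y \<or> x = z \<or> y = z)"
  then have d: "distinct [x, y, z]" by simp
  note A' = A[THEN sym]
  obtain m where m: "m \<noteq> l" "A i x k m" "A i y k m"
    using overlap[OF _ A'(1,2)] d by auto
  obtain m' where m': "m' \<noteq> l" "A i x k m'" "A i z k m'"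
    using overlap[OF _ A'(1,3)] d by auto
  have "m' = m"
    using sparseD[OF assms A'(1) m(2) m'(2)] m(1) m'(1) by auto
  moreover have r: "i < 6" "k < 6" "x < 6" "y < 6" "z < 6" "l < 6" "m < 6"
    using A m less_six by blast+
  moreover obtain t where "t \<noteq> l" "t \<noteq> m" "A i x k t \<or> A i y k t \<or> A i z k t"
    using three_in_two[OF r(1,2) d r(3-7)] m(1) by auto
  ultimately show False
    using assms A' m m' unfolding sparse_def by metis
qed

lemma coherent_rows:
  assumes "i < 6" "k < 6" "distinct S" "set S = {..<6}"
  shows "coherent S (\<lambda>x y. A i x k y)"
  unfolding coherent_def
proof (intro conjI ballI sorted_wrt_if_distinct assms impI)
  fix x assume "x \<in> set S"
  then show "\<exists>y\<in>set S. A i x k y"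
    using nonempty[of i x k] assms less_six by fastforce
next
  fix x x' y assume "x \<noteq> x'" "A i x k y \<and> A i x' k y"
  then show "\<exists>z\<in>set S. z \<noteq> y \<and> A i x k z \<and> A i x' k z"
    using overlap[of x x' i k y] assms less_six by fastforce
qed

lemma no_three_in_two_rows:
  assumes "i < 6" "k < 6" "distinct S" "set S = {..<6}"
  shows "no_three_in_two S (\<lambda>x y. A i x k y)"
  unfolding no_three_in_two_def
proof (intro triplewise_if_distinct sorted_wrt_if_distinct assms)
  fix j1 j2 j3 x y
  assume "j1 \<in> set S" "j2 \<in> set S" "j3 \<in> set S" "j1 \<noteq> j2" "j1 \<noteq> j3" "j2 \<noteq> j3" "x \<in> set S" "y \<in> set S" "x \<noteq> y"
  then show "\<exists>z\<in>set S. z \<noteq> x \<and> z \<noteq> y \<and> (A i j1 k z \<or> A i j2 k z \<or> A i j3 k z)"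
    using three_in_two[of i k j1 j2 j3 x y] assms less_six by fastforce
qed

lemma factors_rows:
  assumes "r < 6" "set S = {..<6}"
  shows "factors_on S (\<lambda>x y. A i x k y) (\<lambda>x y. A i x r y) (\<lambda>x y. A r x k y)"
  unfolding factors_on_def using via[OF assms(1)] less_six assms(2) by blast

lemma sparse_on_rows:
  assumes "sparse A i k" "distinct S"
  shows "sparse_on S (\<lambda>x y. A i x k y)"
  unfolding sparse_on_def
  using sparseD[OF assms(1)] by (intro ballI triplewise_if_distinct assms(2)) blast

lemma sparse_if_sparse_on:
  assumes "sparse_on S (\<lambda>x y. A i x k y)" "set S = {..<6}"
  shows "sparse A i k"
  unfolding sparse_def
proof (intro allI impI, rule ccontr)
  fix j x y z
  assume A: "A i j k x" "A i j k y" "A i j k z" "\<not> (x = y \<or> x = z \<or> y = z)"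
  then have S: "j \<in> set S" "x \<in> set S" "y \<in> set S" "z \<in> set S"
    using less_six assms(2) by blast+
  then have "triplewise (\<lambda>x y z. \<not> (A i j k x \<and> A i j k y \<and> A i j k z)) S"
    using assms(1) by (simp add: sparse_on_def)
  from triplewiseD[OF this S(2-4)] show False
    using A by blast
qed

text \<open>In terms of the basis in row \<open>i2\<close>, the cells \<open>p, p'\<close> of row \<open>i0\<close> span the same plane as the
  cells \<open>l, e\<close>, and the cells \<open>q, q'\<close> of row \<open>i1\<close> span the same plane as \<open>e, m\<close>.\<close>

lemma dense_from_sparse:
  assumes sp: "sparse A i0 i2" "sparse A i1 i2" and dense: "\<not> sparse A i0 i1" and i2: "i2 < 6"
  obtains l e m p p' q q' where "distinct [l, e, m]" "p \<noteq> p'" "q \<noteq> q'"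
    "\<forall>x\<in>{p, p'}. A i0 x i2 l \<and> A i0 x i2 e \<and> (\<forall>y\<in>{q, q'}. A i0 x i1 y)"
    "\<forall>y\<in>{q, q'}. A i1 y i2 e \<and> A i1 y i2 m"
proof -
  note sp' = sparse_swap[OF sp(1)] sparse_swap[OF sp(2)]
  obtain p y1 y2 y3 where y: "A i0 p i1 y1" "A i0 p i1 y2" "A i0 p i1 y3" "y1 \<noteq> y2" "y1 \<noteq> y3" "y2 \<noteq> y3"
    using dense unfolding sparse_def by blast
  obtain m1 m2 m3 where m: "A i0 p i2 m1" "A i2 m1 i1 y1" "A i0 p i2 m2" "A i2 m2 i1 y2" "A i0 p i2 m3" "A i2 m3 i1 y3"
    using via[OF i2 y(1)] via[OF i2 y(2)] via[OF i2 y(3)] by blast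
  \<comment> \<open>The cell \<open>p\<close> meets at most two cells of row \<open>i2\<close>, so
    two of the three paths from \<open>p\<close> to row \<open>i1\<close> share their middle cell.
    All three cannot, as that cell would meet three cells of row \<open>i1\<close>.\<close>
  have two: "m1 = m2 \<or> m1 = m3 \<or> m2 = m3"
    by (rule sparseD[OF sp(1) m(1,3,5)])
  have notall: "\<not> (m1 = m2 \<and> m1 = m3)"
    using sparseD[OF sp'(2)] m y by metis
  \<comment> \<open>\<open>e\<close> is the shared middle cell, with ends \<open>q, q'\<close>;
    \<open>l\<close> is the other one, with end \<open>t\<close>.\<close>
  obtain e l q q' t where e: "e \<noteq> l" "A i0 p i2 e" "A i0 p i2 l" "q \<noteq> q'" "q \<noteq> t" "q' \<noteq> t"
    "A i2 e i1 q" "A i2 e i1 q'" "A i2 l i1 t"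
    using two notall m y that by metis
  obtain p' where p': "p' \<noteq> p" "A i2 e i0 p'" "A i2 l i0 p'"
    using overlap[OF e(1)] e(2,3)[THEN sym] by blast
  obtain m where m: "m \<noteq> e" "A i1 q i2 m" "A i1 q' i2 m"
    using overlap[OF e(4)] e(7,8)[THEN sym] by blast
  \<comment> \<open>Otherwise \<open>l\<close> would meet \<open>q\<close>, \<open>q'\<close> and
    \<open>t\<close>.\<close>
  have "m \<noteq> l"
    using sparseD[OF sp'(2), of l q q' t] m(2,3)[THEN sym] e by blast
  have P: "\<forall>x\<in>{p, p'}. A i0 x i2 l \<and> A i0 x i2 e"
    using e p' sym by blast
  have Q: "\<forall>y\<in>{q, q'}. A i1 y i2 e \<and> A i1 y i2 m"
    using e m sym by blast
  \<comment> \<open>The supports \<open>{l, e}\<close> and \<open>{e, m}\<close> in row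
    \<open>i2\<close> share only \<open>e\<close>, so \<open>single\<close> applies.\<close>
  have "A i0 x i1 y" if "x \<in> {p, p'}" "y \<in> {q, q'}" for x y
  proof (rule single)
    show "A i0 x i2 e" "A i1 y i2 e" using P Q that by blast+
    fix e' assume "A i0 x i2 e'" "A i1 y i2 e'"
    then have "e' \<in> {l, e}" "e' \<in> {e, m}"
      using P Q that e(1) m(1) sparseD[OF sp(1), of x l e e'] sparseD[OF sp(2), of y e m e'] by blast+
    then show "e' = e" using \<open>m \<noteq> l\<close> by blast
  qed
  then show ?thesis
    using that[of l e m p p' q q'] P Q \<open>m \<noteq> l\<close> e(1,4) m(1) p'(1) by auto
qed

end

text \<open>Among \<open>l, e, m\<close> only \<open>m\<close> can lie in \<open>{p, p'}\<close> and
  only \<open>l\<close> in \<open>{q, q'}\<close>. The alternatives of the conclusion are the cases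
  where at least one does; if neither did, there would be seven different columns.\<close>

lemma plane_labels:
  fixes l e m p p' q q' :: nat
  assumes "distinct [l, e, m]" "distinct [p, p', q, q']" "{p, p'} \<inter> {l, e} = {}" "{q, q'} \<inter> {e, m} = {}"
    and lt: "l < 6" "e < 6" "m < 6" "p < 6" "p' < 6" "q < 6" "q' < 6"
  obtains c3 c4 c5 where "distinct [l, e, m, c3, c4, c5]" "set [l, e, m, c3, c4, c5] = {..<6}"
    "{p, p'} = {m, c3} \<and> {q, q'} = {l, c4} \<or> {p, p'} = {m, c3} \<and> {q, q'} = {c4, c5} \<or> {p, p'} = {c3, c4} \<and> {q, q'} = {l, c5}"
proof -
  have exhaust: "set xs = {..<6}" if "distinct xs" "length xs = 6" "\<forall>x\<in>set xs. x < 6" for xs :: "nat list"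
    using that distinct_card[of xs] by (intro card_subset_eq) auto
  have P: "{p, p'} \<inter> {q, q'} = {}" "p \<noteq> p'" "q \<noteq> q'"
    using assms(2) by auto
  consider (1) "m \<in> {p, p'}" "l \<in> {q, q'}" | (2) "m \<in> {p, p'}" "l \<notin> {q, q'}"
    | (3) "m \<notin> {p, p'}" "l \<in> {q, q'}" | (4) "m \<notin> {p, p'}" "l \<notin> {q, q'}"
    by blast
  then show ?thesis
  proof cases
    case 1
    then obtain c3 c4 where c: "{p, p'} = {m, c3}" "m \<noteq> c3" "{q, q'} = {l, c4}" "l \<noteq> c4"
      using P by (metis doubleton_eq_iff insertE singletonD)
    have "card (set [l, e, m, c3, c4]) < card {..<6::nat}"
      using card_length[of "[l, e, m, c3, c4]"] by simp
    then have "\<not> {..<6} \<subseteq> set [l, e, m, c3, c4]"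
      using card_mono[of "set [l, e, m, c3, c4]" "{..<6}"] by fastforce
    then obtain c5 where c5: "c5 < 6" "c5 \<notin> set [l, e, m, c3, c4]" by blast
    have "distinct [l, e, m, c3, c4, c5]"
      using assms(1,3,4) P c c5 by auto
    moreover have "c3 < 6" "c4 < 6"
      using c lt by (metis insertE insertI1 insert_commute singletonD)+
    ultimately show ?thesis
      using that[of c3 c4 c5] exhaust[of "[l, e, m, c3, c4, c5]"] c c5 lt by auto
  next
    case 2
    then obtain c3 where c: "{p, p'} = {m, c3}" "m \<noteq> c3"
      using P by (metis doubleton_eq_iff insertE singletonD)
    have "distinct [l, e, m, c3, q, q']"
      using assms(1,3,4) P c 2 by auto
    moreover have "c3 < 6"
      using c lt by (metis insertE insertI1 insert_commute singletonD)
    ultimately show ?thesis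
      using that[of c3 q q'] exhaust[of "[l, e, m, c3, q, q']"] c lt by auto
  next
    case 3
    then obtain c5 where c: "{q, q'} = {l, c5}" "l \<noteq> c5"
      using P by (metis doubleton_eq_iff insertE singletonD)
    have "distinct [l, e, m, p, p', c5]"
      using assms(1,3,4) P c 3 by auto
    moreover have "c5 < 6"
      using c lt by (metis insertE insertI1 insert_commute singletonD)
    ultimately show ?thesis
      using that[of p p' c5] exhaust[of "[l, e, m, p, p', c5]"] c lt by auto
  next
    case 4
    have "distinct [l, e, m, p, p', q, q']"
      using assms(1,2,3,4) 4 by auto
    then have "card (set [l, e, m, p, p', q, q']) = 7"
      by (subst distinct_card) simp_all
    moreover have "card (set [l, e, m, p, p', q, q']) \<le> card {..<6::nat}"
      using lt by (intro card_mono) auto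
    ultimately show ?thesis by simp
  qed
qed

text \<open>The patterns of two orthogonal squares. Both assumptions compare different rows; cells
  within one row are governed by \<open>same_row\<close>.\<close>

locale exclusive_pair = A: nonorthogonality A + B: nonorthogonality B for A B +
  assumes column: "i \<noteq> k \<Longrightarrow> \<not> A i j k j \<and> \<not> B i j k j"
    and exclusive: "i \<noteq> k \<Longrightarrow> \<not> (A i j k l \<and> B i j k l)"
begin

lemma exclusive_rows: "i \<noteq> k \<Longrightarrow> exclusive_on S (\<lambda>x y. A i x k y) (\<lambda>x y. B i x k y)"
  using column exclusive by (simp add: exclusive_on_def)

text \<open>Listing the columns with the dense cell first and its three partners next reduces this
  to \<open>two_rows\<close>; by \<open>column\<close> the cell is none of its partners.\<close>

lemma sparse_if_dense:
  assumes "i < 6" "k < 6" "i \<noteq> k" "\<not> sparse A i k"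
  shows "sparse B i k"
proof -
  obtain j x y z where A: "A i j k x" "A i j k y" "A i j k z" and d: "x \<noteq> y" "x \<noteq> z" "y \<noteq> z"
    using assms(4) unfolding sparse_def by blast
  have j: "distinct [j, x, y, z]"
    using d A column[OF assms(3), of j] by auto
  have lt: "j < 6" "x < 6" "y < 6" "z < 6"
    using A A.less_six by blast+
  have "card ({..<6} - set [j, x, y, z]) = 2"
    using lt distinct_card[OF j] by (subst card_Diff_subset) auto
  then obtain c4 c5 where c: "{..<6} - set [j, x, y, z] = {c4, c5}" "c4 \<noteq> c5"
    by (meson card_2_iff)
  define S where "S = [j, x, y, z, c4, c5]"
  have c': "c4 \<in> {..<6} - set [j, x, y, z]" "c5 \<in> {..<6} - set [j, x, y, z]"
    unfolding c by simp_all
  have S: "distinct [j, x, y, z, c4, c5]" "distinct S"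
    using j c c' by (auto simp: S_def)
  have "set S = set [j, x, y, z] \<union> ({..<6} - set [j, x, y, z])"
    unfolding c by (auto simp: S_def)
  also have "\<dots> = {..<6}"
    using lt by auto
  finally have set: "set S = {..<6}" .
  \<comment> \<open>By symmetry a transposed pattern belongs to the same rows in opposite order, so
    the row lemmas also supply the column conditions.\<close>
  have tr: "(\<lambda>a b. A i b k a) = (\<lambda>a b. A k a i b)" "(\<lambda>a b. B i b k a) = (\<lambda>a b. B k a i b)"
    using A.sym_iff B.sym_iff by blast+
  have "sparse_on S (\<lambda>a b. B i a k b)"
    by (rule two_rows[OF S(1) S_def, where U = "\<lambda>a b. A i a k b"]; (unfold tr)?;
        intro exclusive_rows A.coherent_rows B.coherent_rows A.no_three_in_two_rows B.no_three_in_two_rows assms S set A)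
  then show ?thesis
    using set by (rule B.sparse_if_sparse_on)
qed

text \<open>\<open>dense_from_sparse\<close> yields the two planes, \<open>plane_labels\<close> the
  possible positions of their cells, and \<open>three_rows\<close> settles each position.\<close>

lemma sparse_third_row:
  assumes lt: "i0 < 6" "i1 < 6" "i2 < 6" and ne: "i0 \<noteq> i1" "i0 \<noteq> i2" "i1 \<noteq> i2"
    and sp: "sparse A i0 i2" "sparse A i1 i2" "sparse B i0 i1" and dense: "\<not> sparse A i0 i1"
  shows "sparse B i0 i2"
proof -
  obtain l e m p p' q q' where lem: "distinct [l, e, m]" and pp: "p \<noteq> p'" and qq: "q \<noteq> q'"
    and P: "\<forall>x\<in>{p, p'}. A i0 x i2 l \<and> A i0 x i2 e \<and> (\<forall>y\<in>{q, q'}. A i0 x i1 y)"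
    and Q: "\<forall>y\<in>{q, q'}. A i1 y i2 e \<and> A i1 y i2 m"
    using A.dense_from_sparse[OF sp(1,2) dense lt(3)] by blast
  have "{p, p'} \<inter> {l, e} = {}" "{q, q'} \<inter> {e, m} = {}" "{p, p'} \<inter> {q, q'} = {}"
    using P Q column ne by blast+
  moreover have "l < 6" "e < 6" "m < 6" "p < 6" "p' < 6" "q < 6" "q' < 6"
    using P Q A.less_six by blast+
  ultimately obtain c3 c4 c5 where S: "distinct [l, e, m, c3, c4, c5]" "set [l, e, m, c3, c4, c5] = {..<6}"
    and PQ: "{p, p'} = {m, c3} \<and> {q, q'} = {l, c4} \<or> {p, p'} = {m, c3} \<and> {q, q'} = {c4, c5} \<or>
      {p, p'} = {c3, c4} \<and> {q, q'} = {l, c5}"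
    using plane_labels[of l e m p p' q q'] lem pp qq by auto
  note sp' = sp(1,2)[THEN A.sparse_swap] sp(3)[THEN B.sparse_swap]
  have trA: "(\<lambda>a b. A i0 b i1 a) = (\<lambda>a b. A i1 a i0 b)" "(\<lambda>a b. A i0 b i2 a) = (\<lambda>a b. A i2 a i0 b)"
    "(\<lambda>a b. A i1 b i2 a) = (\<lambda>a b. A i2 a i1 b)"
    using A.sym_iff by blast+
  have trB: "(\<lambda>a b. B i0 b i1 a) = (\<lambda>a b. B i1 a i0 b)" "(\<lambda>a b. B i0 b i2 a) = (\<lambda>a b. B i2 a i0 b)"
    "(\<lambda>a b. B i1 b i2 a) = (\<lambda>a b. B i2 a i1 b)"
    using B.sym_iff by blast+
  have "sparse_on [l, e, m, c3, c4, c5] (\<lambda>a b. B i0 a i2 b)"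
    by (rule three_rows[OF S(1) refl, where ?U01.0 = "\<lambda>a b. A i0 a i1 b" and ?U02.0 = "\<lambda>a b. A i0 a i2 b"
          and ?U12.0 = "\<lambda>a b. A i1 a i2 b" and ?V01.0 = "\<lambda>a b. B i0 a i1 b" and ?V12.0 = "\<lambda>a b. B i1 a i2 b"
          and P = "{p, p'}" and Q = "{q, q'}", OF _ _ _ _ _ _ _ _ _ _ _ _ _ _ _ _ _ _ _ P Q PQ];
        (unfold trA trB)?;
        intro exclusive_rows A.coherent_rows B.coherent_rows A.factors_rows B.factors_rows
          A.sparse_on_rows B.sparse_on_rows sp sp' lt ne S)
  then show ?thesis
    using S(2) by (rule B.sparse_if_sparse_on)
qed

lemma exclusive_pair_swap: "exclusive_pair B A"
  using column exclusive by unfold_locales blast+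

end

text \<open>Otherwise some pair \<open>r, i\<close> is not sparse for \<open>A\<close> and some pair
  \<open>r, k\<close> is not sparse for \<open>B\<close>; by \<open>sparse_if_dense\<close> each is
  sparse for the other pattern. The pair \<open>i, k\<close> is sparse for \<open>A\<close> or for
  \<open>B\<close>, and \<open>sparse_third_row\<close> then makes \<open>r, k\<close> sparse for
  \<open>B\<close> or \<open>r, i\<close> sparse for \<open>A\<close>.\<close>

lemma (in exclusive_pair) sparse_row:
  assumes r: "r < 6"
  shows "(\<forall>i<6. sparse A i r) \<or> (\<forall>i<6. sparse B i r)"
proof (rule ccontr)
  interpret swapped: exclusive_pair B A
    by (rule exclusive_pair_swap)
  assume "\<not> ?thesis"
  then obtain i k where i: "i < 6" "\<not> sparse A r i" and k: "k < 6" "\<not> sparse B r k"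
    using A.sparse_swap B.sparse_swap by blast
  have "sparse A r r" "sparse B r r"
    unfolding sparse_def using A.same_row B.same_row A.less_six B.less_six by metis+
  then have ne: "r \<noteq> i" "r \<noteq> k"
    using i k by blast+
  have sp: "sparse B r i" "sparse A r k"
    using sparse_if_dense[OF r i(1) ne(1) i(2)] swapped.sparse_if_dense[OF r k(1) ne(2) k(2)] by blast+
  then have "i \<noteq> k"
    using k by blast
  show False
  proof (cases "sparse A i k")
    case True
    then show False
      using sparse_third_row[OF r i(1) k(1) ne \<open>i \<noteq> k\<close> sp(2) _ sp(1) i(2)] k(2) by blast
  next
    case False
    then have "sparse B k i"
      using sparse_if_dense[OF i(1) k(1) \<open>i \<noteq> k\<close>] B.sparse_swap by blast
    then show False
      using swapped.sparse_third_row[OF r k(1) i(1) ne(2,1) _ sp(1) _ sp(2) k(2)] \<open>i \<noteq> k\<close> i(2) by blast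
  qed
qed

section \<open>Orthogonal quantum Latin squares of order 6\<close>

lemma nonorthogonality_QLS:
  assumes "QLS 6 \<Psi>"
  shows "nonorthogonality (nonorth 6 \<Psi>)"
proof
  show "nonorth 6 \<Psi> i j i l \<longleftrightarrow> j = l" if "i < 6" "j < 6" for i j l
    using that assms by (auto simp: nonorth_def QLS_row split: if_splits)
  show "\<exists>m. nonorth 6 \<Psi> i j r m \<and> nonorth 6 \<Psi> r m k l" if "r < 6" "nonorth 6 \<Psi> i j k l" for r i j k l
    using assms that by (rule nonorth_via)
  show "nonorth 6 \<Psi> i j k l" if "nonorth 6 \<Psi> i j r m" "nonorth 6 \<Psi> k l r m"
    "\<And>m'. nonorth 6 \<Psi> i j r m' \<Longrightarrow> nonorth 6 \<Psi> k l r m' \<Longrightarrow> m' = m" for i j r m k l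
    using assms that by (rule nonorth_single)
  show "\<exists>z. z \<noteq> x \<and> z \<noteq> y \<and> (nonorth 6 \<Psi> i j1 k z \<or> nonorth 6 \<Psi> i j2 k z \<or> nonorth 6 \<Psi> i j3 k z)"
    if "i < 6" "k < 6" "distinct [j1, j2, j3]" "j1 < 6" "j2 < 6" "j3 < 6" "x < 6" "y < 6" "x \<noteq> y" for i k j1 j2 j3 x y
    using assms that by (rule nonorth_three_in_two)
  show "nonorth 6 \<Psi> k l i j" if "nonorth 6 \<Psi> i j k l" for i j k l
    using that by (rule nonorth_sym)
qed (simp add: nonorth_def)

theorem mainTheorem10:
  assumes "\<exists>\<Psi> \<Phi>. QLS 6 \<Psi> \<and> QLS 6 \<Phi> \<and> orthogonal_QLS 6 \<Psi> \<Phi>"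
  shows "\<exists>\<Psi> \<Phi>. QLS 6 \<Psi> \<and> QLS 6 \<Phi> \<and> orthogonal_QLS 6 \<Psi> \<Phi> \<and> classical_QLS 6 \<Psi>"
proof -
  from assms obtain \<Psi> \<Phi> where Q: "QLS 6 \<Psi>" "QLS 6 \<Phi>" and orth: "orthogonal_QLS 6 \<Psi> \<Phi>"
    by blast
  note orth' = orth[unfolded orthogonal_QLS_iff[OF Q]]
  then have orth_swap: "orthogonal_QLS 6 \<Phi> \<Psi>"
    unfolding orthogonal_QLS_iff[OF Q(2,1)] by blast
  interpret exclusive_pair "nonorth 6 \<Psi>" "nonorth 6 \<Phi>"
  proof (intro exclusive_pair.intro exclusive_pair_axioms.intro nonorthogonality_QLS Q)
    show "\<not> nonorth 6 \<Psi> i j k j \<and> \<not> nonorth 6 \<Phi> i j k j" if "i \<noteq> k" for i k j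
      using that Q by (auto simp: nonorth_def QLS_column)
    show "\<not> (nonorth 6 \<Psi> i j k l \<and> nonorth 6 \<Phi> i j k l)" if "i \<noteq> k" for i k j l
      using that orth' unfolding nonorth_def by blast
  qed
  from sparse_row[of 0] consider "\<And>i. i < 6 \<Longrightarrow> sparse (nonorth 6 \<Psi>) i 0"
    | "\<And>i. i < 6 \<Longrightarrow> sparse (nonorth 6 \<Phi>) i 0"
    by auto
  then show ?thesis
  proof cases
    case 1
    then show ?thesis
      using classical_mate_if_sparse[OF Q orth] Q by auto
  next
    case 2
    \<comment> \<open>By symmetry of orthogonality the classical square replaces
      \<open>\<Phi>\<close> here and becomes the first of the pair, with \<open>\<Psi>\<close>
      second.\<close>
    then show ?thesis
      using classical_mate_if_sparse[OF Q(2,1) orth_swap] Q by auto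
  qed
qed

end
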